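(* For every weak selection $f$ on $\mathbb{R}$ with $\mathcal{P}(\mathbb{R})\neq\mathcal{M}_f$ and for every $x\in\mathbb{R}$ there is a weak selection $g$ on $\mathbb{R}$ such that $g\cong^*_{\{x\}}f$ and $\mathcal{M}_g=\mathcal{P}(\mathbb{R})\neq\mathcal{M}_f$.
   Context: A weak selection on $\mathbb{R}$ is a function $f:[\mathbb{R}]^2\to\mathbb{R}$ with $f(F)\in F$ for every two-element set $F\subseteq\mathbb{R}$. For distinct $x,y$ write $x<_f y$ if $f(\{x,y\})=x$, and $x\leq_f y$ if $x<_f y$ or $x=y$. For $r,s\in\mathbb{R}$, $(r,s]_f=\{x\in\mathbb{R}: r<_f x\leq_f s\}$ (it is not required that $r<_f s$). For $A\subseteq\mathbb{R}$, $\lambda_f(A)=\inf\{\sum_{n\in\mathbb{N}}|s_n-r_n| : A\subseteq\bigcup_{n\in\mathbb{N}}(r_n,s_n]_f\}$ if $A$ can be covered by countably many intervals $(r,s]_f$, and $\lambda_f(A)=+\infty$ otherwise; $\lambda_f$ is an outer measure. $\mathcal{M}_f$ is the family of $\lambda_f$-measurable (in the sense of Carathéodory) subsets of $\mathbb{R}$; $\mathcal{P}(\mathbb{R})$ is the power set. For $N\subseteq\mathbb{R}$, $f\cong^*_N g$ ($f$ and $g$ are weakly congruent mod $N$) means: for all distinct $r,s\in\mathbb{R}$ with $\{r,s\}\cap N=\emptyset$, $r<_g s$ iff $r<_f s$. *)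

theory Defs
  imports "HOL-Analysis.Analysis"
begin

text \<open>The values of \<open>f\<close> on sets that do not have exactly two elements are arbitrary;
  none of the notions below depends on them.\<close>

definition weak_selection :: "(real set \<Rightarrow> real) \<Rightarrow> bool" where
  "weak_selection f \<longleftrightarrow> (\<forall>F. card F = 2 \<longrightarrow> f F \<in> F)"

definition sel_less :: "(real set \<Rightarrow> real) \<Rightarrow> real \<Rightarrow> real \<Rightarrow> bool" where
  "sel_less f x y \<longleftrightarrow> x \<noteq> y \<and> f {x, y} = x"

definition sel_le :: "(real set \<Rightarrow> real) \<Rightarrow> real \<Rightarrow> real \<Rightarrow> bool" where
  "sel_le f x y \<longleftrightarrow> sel_less f x y \<or> x = y"

definition sel_interval :: "(real set \<Rightarrow> real) \<Rightarrow> real \<Rightarrow> real \<Rightarrow> real set" where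
  "sel_interval f r s = {x. sel_less f r x \<and> sel_le f x s}"

text \<open>If no countable family of intervals covers \<open>A\<close>, this is the infimum of the
  empty set in \<^typ>\<open>ennreal\<close>, that is, \<open>\<infinity>\<close>.\<close>

definition sel_outer :: "(real set \<Rightarrow> real) \<Rightarrow> real set \<Rightarrow> ennreal" where
  "sel_outer f A = Inf {(\<Sum>n. ennreal \<bar>s n - r n\<bar>) | (r :: nat \<Rightarrow> real) (s :: nat \<Rightarrow> real).
     A \<subseteq> (\<Union>n. sel_interval f (r n) (s n))}"

definition sel_measurable :: "(real set \<Rightarrow> real) \<Rightarrow> real set set" where
  "sel_measurable f = lambda_system UNIV (Pow UNIV) (sel_outer f)"

definition weakly_congruent_mod ::
    "real set \<Rightarrow> (real set \<Rightarrow> real) \<Rightarrow> (real set \<Rightarrow> real) \<Rightarrow> bool" where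
  "weakly_congruent_mod N f g \<longleftrightarrow>
     (\<forall>r s. r \<noteq> s \<and> {r, s} \<inter> N = {} \<longrightarrow> (sel_less g r s \<longleftrightarrow> sel_less f r s))"

end

theory Submission
  imports Defs
begin

text \<open>Any sequence of points \<open>s\<^sub>n \<noteq> x\<close> converging fast to \<open>x\<close>, here \<open>s\<^sub>n = x + (1/2)^n\<close>, makes
  everything except \<open>x\<close> a null set once the comparisons with \<open>x\<close> are chosen suitably. A point
  \<open>y \<noteq> x\<close> satisfies \<open>y \<le>\<^sub>f s\<^sub>n\<close> infinitely often, or else \<open>s\<^sub>n <\<^sub>f y\<close> from some index on. Let \<open>g\<close>
  agree with \<open>f\<close> off \<open>x\<close>, and put \<open>x\<close> below \<open>y\<close> in the first case and above \<open>y\<close> in the second.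
  Then \<open>y\<close> lies in \<open>(x, s\<^sub>n]\<^sub>g\<close> in the first case and in \<open>(s\<^sub>n, x]\<^sub>g\<close> in the second, for arbitrarily
  large \<open>n\<close>. These intervals have length \<open>(1/2)^n\<close>, so their tails cover \<open>\<real> - {x}\<close> at arbitrarily
  small total cost (\<open>sel_outer_Compl_eq_0\<close>). An outer measure for which the complement of a point
  is null is concentrated at that point, and every set either contains the point or misses it;
  hence every set is measurable (\<open>sel_measurable_eq_Pow\<close>).\<close>

lemma sel_outer_le:
  assumes "A \<subseteq> (\<Union>n. sel_interval f (r n) (s n))"
  shows "sel_outer f A \<le> (\<Sum>n. ennreal \<bar>s n - r n\<bar>)"
  unfolding sel_outer_def using assms by (intro Inf_lower) blast

lemma sel_outer_mono:
  assumes "A \<subseteq> B"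
  shows "sel_outer f A \<le> sel_outer f B"
  unfolding sel_outer_def using assms by (intro Inf_superset_mono) blast

lemma suminf_interleave_ennreal:
  fixes a b :: "nat \<Rightarrow> ennreal"
  shows "(\<Sum>n. if even n then a (n div 2) else b (n div 2)) = suminf a + suminf b"
    (is "suminf ?c = _")
proof -
  have partial: "sum ?c {..<2 * n} = sum a {..<n} + sum b {..<n}" for n
    by (induction n) (simp_all add: ac_simps)
  have "(\<lambda>n. sum ?c {..<n}) \<longlonglongrightarrow> suminf ?c"
    by (rule summable_LIMSEQ) simp
  moreover have "strict_mono (\<lambda>n::nat. 2 * n)"
    by (simp add: strict_mono_def)
  ultimately have "(\<lambda>n. sum ?c {..<2 * n}) \<longlonglongrightarrow> suminf ?c"
    using LIMSEQ_subseq_LIMSEQ[of "\<lambda>n. sum ?c {..<n}" "suminf ?c" "\<lambda>n. 2 * n"]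
    by (simp add: o_def)
  moreover have "(\<lambda>n. sum ?c {..<2 * n}) \<longlonglongrightarrow> suminf a + suminf b"
    unfolding partial by (intro tendsto_add summable_LIMSEQ) simp_all
  ultimately show ?thesis
    by (rule LIMSEQ_unique)
qed

text \<open>Two covers combine into one by interleaving them.\<close>

lemma sel_outer_Un_le:
  "sel_outer f (A \<union> B) \<le> sel_outer f A + sel_outer f B"
proof (rule ennreal_le_epsilon)
  fix e :: real
  assume finite: "sel_outer f A + sel_outer f B < top" and "0 < e"
  have cover: "\<exists>r s. C \<subseteq> (\<Union>n. sel_interval f (r n) (s n)) \<and>
      (\<Sum>n. ennreal \<bar>s n - r n\<bar>) < sel_outer f C + ennreal (e / 2)"
    if "sel_outer f C < top" for C
  proof -
    have "sel_outer f C < sel_outer f C + ennreal (e / 2)"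
      using that \<open>0 < e\<close> by (simp add: ennreal_add_left_cancel_less less_top)
    then show ?thesis
      unfolding sel_outer_def[of f C] Inf_less_iff by blast
  qed
  have "sel_outer f A < top" "sel_outer f B < top"
    using finite by simp_all
  then obtain r s r' s' where
    A: "A \<subseteq> (\<Union>n. sel_interval f (r n) (s n))"
    and sum_A: "(\<Sum>n. ennreal \<bar>s n - r n\<bar>) < sel_outer f A + ennreal (e / 2)"
    and B: "B \<subseteq> (\<Union>n. sel_interval f (r' n) (s' n))"
    and sum_B: "(\<Sum>n. ennreal \<bar>s' n - r' n\<bar>) < sel_outer f B + ennreal (e / 2)"
    using cover by meson
  define R where "R n = (if even n then r (n div 2) else r' (n div 2))" for n
  define S where "S n = (if even n then s (n div 2) else s' (n div 2))" for n
  have "sel_interval f (R (2 * n)) (S (2 * n)) = sel_interval f (r n) (s n)"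
    "sel_interval f (R (2 * n + 1)) (S (2 * n + 1)) = sel_interval f (r' n) (s' n)" for n
    by (simp_all add: R_def S_def)
  then have "sel_interval f (r n) (s n) \<subseteq> (\<Union>n. sel_interval f (R n) (S n))"
    "sel_interval f (r' n) (s' n) \<subseteq> (\<Union>n. sel_interval f (R n) (S n))" for n
    using UN_upper[of "2 * n" UNIV "\<lambda>n. sel_interval f (R n) (S n)"]
      UN_upper[of "2 * n + 1" UNIV "\<lambda>n. sel_interval f (R n) (S n)"] by simp_all
  then have "A \<union> B \<subseteq> (\<Union>n. sel_interval f (R n) (S n))"
    by (intro Un_least order_trans[OF A] order_trans[OF B] UN_least)
  then have "sel_outer f (A \<union> B) \<le> (\<Sum>n. ennreal \<bar>S n - R n\<bar>)"
    by (rule sel_outer_le)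
  also have "(\<lambda>n. ennreal \<bar>S n - R n\<bar>) =
      (\<lambda>n. if even n then ennreal \<bar>s (n div 2) - r (n div 2)\<bar>
           else ennreal \<bar>s' (n div 2) - r' (n div 2)\<bar>)"
    by (auto simp: R_def S_def)
  also have "suminf \<dots> = (\<Sum>n. ennreal \<bar>s n - r n\<bar>) + (\<Sum>n. ennreal \<bar>s' n - r' n\<bar>)"
    by (rule suminf_interleave_ennreal)
  also have "\<dots> \<le> (sel_outer f A + ennreal (e / 2)) + (sel_outer f B + ennreal (e / 2))"
    using sum_A sum_B by (intro add_mono) simp_all
  also have "\<dots> = sel_outer f A + sel_outer f B + (ennreal (e / 2) + ennreal (e / 2))"
    by (simp add: ac_simps)
  also have "ennreal (e / 2) + ennreal (e / 2) = ennreal e"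
    using \<open>0 < e\<close> by (simp flip: ennreal_plus)
  finally show "sel_outer f (A \<union> B) \<le> sel_outer f A + sel_outer f B + ennreal e" .
qed

text \<open>Every \<open>E\<close> has the same outer measure as \<open>E \<inter> {x}\<close>, so the Caratheodory condition only has
  to be checked on the single point \<open>x\<close>, which no set can split.\<close>

lemma sel_measurable_eq_Pow:
  assumes null: "sel_outer f (- {x}) = 0"
  shows "sel_measurable f = Pow UNIV"
proof -
  define c where "c = sel_outer f {x}"
  have null_if: "sel_outer f E = 0" if "x \<notin> E" for E
    using sel_outer_mono[of E "- {x}" f] that null by auto
  have point: "sel_outer f E = c" if "x \<in> E" for E
    unfolding c_def
  proof (rule antisym)
    have "sel_outer f E \<le> sel_outer f ({x} \<union> - {x})"
      by (rule sel_outer_mono) auto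
    also have "\<dots> \<le> sel_outer f {x}"
      using sel_outer_Un_le[of f "{x}" "- {x}"] null by simp
    finally show "sel_outer f E \<le> sel_outer f {x}" .
    show "sel_outer f {x} \<le> sel_outer f E"
      using that by (intro sel_outer_mono) simp
  qed
  have "sel_outer f (A \<inter> E) + sel_outer f ((UNIV - A) \<inter> E) = sel_outer f E" for A E
    by (cases "x \<in> E"; cases "x \<in> A") (simp_all add: null_if point)
  then show ?thesis
    unfolding sel_measurable_def lambda_system_def by auto
qed

text \<open>If every point of \<open>A\<close> lies in infinitely many of the intervals, then each tail of the
  sequence covers \<open>A\<close>, and the tails of a convergent series tend to \<open>0\<close>.\<close>

lemma sel_outer_eq_0_if_frequently:
  assumes freq: "\<And>y. y \<in> A \<Longrightarrow> \<exists>\<^sub>F n in sequentially. y \<in> sel_interval f (r n) (s n)"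
    and len: "\<And>n. \<bar>s n - r n\<bar> = (1/2) ^ n"
  shows "sel_outer f A = 0"
proof -
  have "sel_outer f A \<le> ennreal (2 * (1/2) ^ N)" for N
  proof -
    have "A \<subseteq> (\<Union>n. sel_interval f (r (n + N)) (s (n + N)))"
    proof
      fix y assume "y \<in> A"
      then obtain n where "n \<ge> N" "y \<in> sel_interval f (r n) (s n)"
        using freq unfolding frequently_sequentially by blast
      then show "y \<in> (\<Union>n. sel_interval f (r (n + N)) (s (n + N)))"
        by (intro UN_I[of "n - N"]) simp_all
    qed
    then have "sel_outer f A \<le> (\<Sum>n. ennreal \<bar>s (n + N) - r (n + N)\<bar>)"
      by (rule sel_outer_le)
    also have "\<dots> = ennreal (2 * (1/2) ^ N)"
    proof (rule suminf_ennreal_eq)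
      show "(\<lambda>n. \<bar>s (n + N) - r (n + N)\<bar>) sums (2 * (1/2) ^ N)"
        using sums_mult2[OF geometric_sums[of "1/2 :: real"], of "(1/2) ^ N"]
        unfolding len power_add by simp
    qed simp
    finally show ?thesis .
  qed
  moreover have "(\<lambda>N. ennreal (2 * (1/2) ^ N)) \<longlonglongrightarrow> ennreal (2 * 0)"
    by (intro tendsto_ennrealI tendsto_mult tendsto_const LIMSEQ_realpow_zero) simp_all
  ultimately have "sel_outer f A \<le> ennreal (2 * 0)"
    by (intro LIMSEQ_le_const) auto
  then show ?thesis
    by simp
qed

text \<open>\<open>P\<close> is the set of points that are to lie above \<open>x\<close>. For \<open>y \<noteq> x\<close>, the singleton
  \<open>{x, y} - {x}\<close> recovers \<open>y\<close> from the pair \<open>{x, y}\<close>.\<close>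

definition reselect_at :: "real \<Rightarrow> real set \<Rightarrow> (real set \<Rightarrow> real) \<Rightarrow> real set \<Rightarrow> real" where
  "reselect_at x P f F =
     (if x \<in> F then if the_elem (F - {x}) \<in> P then x else the_elem (F - {x}) else f F)"

lemma reselect_at_pair:
  assumes "y \<noteq> x"
  shows "reselect_at x P f {x, y} = (if y \<in> P then x else y)"
proof -
  have "{x, y} - {x} = {y}"
    using assms by auto
  then show ?thesis
    by (simp add: reselect_at_def)
qed

lemma sel_less_reselect_at:
  shows "y \<noteq> x \<Longrightarrow> sel_less (reselect_at x P f) x y \<longleftrightarrow> y \<in> P"
    and "y \<noteq> x \<Longrightarrow> sel_less (reselect_at x P f) y x \<longleftrightarrow> y \<notin> P"
    and "y \<noteq> x \<Longrightarrow> z \<noteq> x \<Longrightarrow> sel_less (reselect_at x P f) y z \<longleftrightarrow> sel_less f y z"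
proof -
  have "{y, x} = {x, y}"
    by auto
  then show "y \<noteq> x \<Longrightarrow> sel_less (reselect_at x P f) x y \<longleftrightarrow> y \<in> P"
    and "y \<noteq> x \<Longrightarrow> sel_less (reselect_at x P f) y x \<longleftrightarrow> y \<notin> P"
    by (simp_all add: sel_less_def reselect_at_pair)
qed (simp add: sel_less_def reselect_at_def)

lemma weak_selection_reselect_at:
  assumes "weak_selection f"
  shows "weak_selection (reselect_at x P f)"
  unfolding weak_selection_def
proof (intro allI impI)
  fix F :: "real set"
  assume F: "card F = 2"
  show "reselect_at x P f F \<in> F"
  proof (cases "x \<in> F")
    case True
    then have "card (F - {x}) = 1"
      using F by (simp add: card_Diff_singleton)
    then obtain y where "F - {x} = {y}"
      by (rule card_1_singletonE)
    then have "y \<noteq> x" "F = {x, y}"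
      using True by auto
    then show ?thesis
      by (simp add: reselect_at_pair)
  next
    case False
    then show ?thesis
      using F assms by (simp add: reselect_at_def weak_selection_def)
  qed
qed

lemma sel_less_linear:
  assumes "weak_selection f" "y \<noteq> z"
  shows "sel_less f y z \<or> sel_less f z y"
proof -
  have "card {y, z} = 2"
    using assms(2) by simp
  then have "f {y, z} \<in> {y, z}"
    using assms(1) unfolding weak_selection_def by blast
  then show ?thesis
    using assms(2) by (auto simp: sel_less_def insert_commute)
qed

text \<open>This choice of \<open>P\<close> places each \<open>y \<noteq> x\<close> on the side of \<open>x\<close> where the short intervals
  between \<open>x\<close> and \<open>x + (1/2)^n\<close> keep catching it.\<close>

lemma sel_outer_Compl_eq_0:
  assumes f: "weak_selection f"
    and P: "P = {y. \<exists>\<^sub>F n in sequentially. sel_le f y (x + (1/2) ^ n)}"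
  shows "sel_outer (reselect_at x P f) (- {x}) = 0"
proof -
  let ?g = "reselect_at x P f"
  let ?s = "\<lambda>n. x + (1/2) ^ n :: real"
  have "sel_outer ?g (P - {x}) = 0"
  proof (rule sel_outer_eq_0_if_frequently)
    fix y assume y: "y \<in> P - {x}"
    then have "\<exists>\<^sub>F n in sequentially. sel_le f y (?s n)"
      by (simp add: P)
    then show "\<exists>\<^sub>F n in sequentially. y \<in> sel_interval ?g x (?s n)"
      using y by (elim frequently_elim1)
        (auto simp: sel_interval_def sel_le_def sel_less_reselect_at)
  qed simp
  moreover have "sel_outer ?g (- P - {x}) = 0"
  proof (rule sel_outer_eq_0_if_frequently)
    fix y assume y: "y \<in> - P - {x}"
    then have "\<forall>\<^sub>F n in sequentially. \<not> sel_le f y (?s n)"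
      by (simp add: P not_frequently)
    then have "\<forall>\<^sub>F n in sequentially. y \<in> sel_interval ?g (?s n) x"
    proof eventually_elim
      case (elim n)
      then have "sel_less f (?s n) y"
        using sel_less_linear[OF f, of y "?s n"] by (auto simp: sel_le_def)
      then show ?case
        using y by (auto simp: sel_interval_def sel_le_def sel_less_reselect_at)
    qed
    then show "\<exists>\<^sub>F n in sequentially. y \<in> sel_interval ?g (?s n) x"
      by (rule eventually_frequently[rotated]) simp
  qed simp
  moreover have "- {x} = (P - {x}) \<union> (- P - {x})"
    by auto
  ultimately show ?thesis
    using sel_outer_Un_le[of ?g "P - {x}" "- P - {x}"] by simp
qed

theorem corollary4p4:
  fixes f :: "real set \<Rightarrow> real" and x :: real
  assumes "weak_selection f"
    and "Pow UNIV \<noteq> sel_measurable f"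
  shows "\<exists>g. weak_selection g \<and> weakly_congruent_mod {x} g f \<and>
    sel_measurable g = Pow UNIV \<and> Pow UNIV \<noteq> sel_measurable f"
proof -
  define P where "P = {y. \<exists>\<^sub>F n in sequentially. sel_le f y (x + (1/2) ^ n)}"
  have "weakly_congruent_mod {x} (reselect_at x P f) f"
    by (simp add: weakly_congruent_mod_def sel_less_reselect_at)
  moreover have "sel_measurable (reselect_at x P f) = Pow UNIV"
    using sel_outer_Compl_eq_0[OF assms(1) P_def] by (rule sel_measurable_eq_Pow)
  ultimately show ?thesis
    using weak_selection_reselect_at assms by blast
qed

end
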